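(* Let $d\ge 2$ be an integer and $p$ an odd prime. For $n\ge0$ let $\alpha_n=\frac{(1/2)_n}{n!}$, where $(x)_n=x(x+1)\cdots(x+n-1)$ (with $(x)_0=1$), and for every integer $s\ge0$ let $$F_{p^s}(z)=\sum_{n=0}^{p^s-1}\alpha_n^d z^n$$ (so $F_1(z)=1$). Let $\epsilon_p=(-1)^{d(p-1)/2}$ and suppose that $F_p(\epsilon_p)$ is a $p$-adic unit. Then $F_{p^s}(\epsilon_p)$ is a $p$-adic unit for every $s\ge 1$, the limit $$f(\epsilon_p)=\lim_{s\to\infty}\frac{F_{p^s}(\epsilon_p)}{F_{p^{s-1}}(\epsilon_p)}$$ exists in $\mathbb{Z}_p$, and $$F_p(\epsilon_p)\equiv f(\epsilon_p)\pmod{p^2}.$$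
   Context: The existence of the limit is a result of Dwork (for any $p$-adic unit $z_0$ with $F_p(z_0)$ a $p$-adic unit, the $F_{p^s}(z_0)$ are $p$-adic units and $F_{p^{s+1}}(z_0)/F_{p^s}(z_0)\equiv F_{p^s}(z_0)/F_{p^{s-1}}(z_0)\pmod{p^s}$ for all $s\ge1$); it is included only to define $f(\epsilon_p)$. Congruences are in $\mathbb{Z}_p$ (the coefficients $\alpha_n$ are $p$-integral rationals). *)

theory Defs
  imports "HOL-Number_Theory.Number_Theory"
begin

definition alpha :: "nat \<Rightarrow> rat" where
  "alpha n = pochhammer (1/2) n / fact n"

definition Ftrunc :: "nat \<Rightarrow> nat \<Rightarrow> rat \<Rightarrow> rat" where
  "Ftrunc d N z = (\<Sum>n<N. alpha n ^ d * z ^ n)"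

definition p_integral :: "nat \<Rightarrow> rat \<Rightarrow> bool" where
  "p_integral p q \<longleftrightarrow> \<not> int p dvd snd (quotient_of q)"

definition p_unit :: "nat \<Rightarrow> rat \<Rightarrow> bool" where
  "p_unit p q \<longleftrightarrow> p_integral p q \<and> \<not> int p dvd fst (quotient_of q)"

definition rat_cong :: "nat \<Rightarrow> rat \<Rightarrow> int \<Rightarrow> nat \<Rightarrow> bool" where
  "rat_cong p q a k \<longleftrightarrow> p_integral p q \<and>
     [fst (quotient_of q) = a * snd (quotient_of q)] (mod (int p ^ k))"

text \<open>p-adic integers as compatible systems of residues a k in [0, p^k)\<close>
definition Zp :: "nat \<Rightarrow> (nat \<Rightarrow> int) \<Rightarrow> bool" where
  "Zp p a \<longleftrightarrow> (\<forall>k. 0 \<le> a k \<and> a k < int p ^ k \<and> a (Suc k) mod (int p ^ k) = a k)"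

definition padic_tendsto :: "nat \<Rightarrow> (nat \<Rightarrow> rat) \<Rightarrow> (nat \<Rightarrow> int) \<Rightarrow> bool" where
  "padic_tendsto p x a \<longleftrightarrow> (\<forall>k. eventually (\<lambda>s. rat_cong p (x s) (a k) k) sequentially)"

end

theory Submission
  imports Defs
begin

text \<open>Put \<open>A n = alpha n ^ d * z ^ n\<close>. Then \<open>A n = R n * A (n div p)\<close> with \<open>R\<close> satisfying
  \<open>R (n + p^k m) \<equiv> R n\<close> modulo \<open>p^k\<close>, and the truncated sum \<open>F_s\<close> is \<open>(T^s 1)(0)\<close> for the transfer
  operator \<open>(T g)(m) = \<Sum>a<p. R (a + p m) g (a + p m)\<close>. On functions that are Lipschitz in the same
  sense as \<open>R\<close>, \<open>T\<close> is a constant plus \<open>p\<close> times a Lipschitz function, so its exterior square is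
  divisible by \<open>p\<close>; this yields Dwork's congruence \<open>F_(s+1) F_(s-1) \<equiv> F_s^2\<close> modulo \<open>p^s\<close>.

  It remains to see that \<open>F_2 \<equiv> F_1^2\<close> modulo \<open>p^2\<close>, for which it suffices that \<open>T 1\<close> is constant
  modulo \<open>p^2\<close>. With \<open>h = (p - 1)/2\<close>, only the digits \<open>a \<le> h\<close> matter since \<open>d \<ge> 2\<close>, and there
  \<open>R (a + p m) \<equiv> R a (1 + p d m (H (h - a) - H a))\<close> with harmonic numbers \<open>H\<close>. Modulo \<open>p\<close> one has
  \<open>alpha a \<equiv> (-1)^a (h choose a)\<close>, so for \<open>z = (-1)^(d h)\<close> the weight \<open>R a\<close> is symmetric under
  \<open>a \<mapsto> h - a\<close> whereas the correction is antisymmetric, and the corrections cancel.\<close>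

section \<open>Rational congruences modulo prime powers\<close>

text \<open>Any denominator prime to \<open>p\<close> certifies integrality, since the reduced
  denominator divides it; ring operations then need no normal forms.\<close>

lemma p_integral_iff:
  "p_integral p q \<longleftrightarrow> (\<exists>a b. \<not> int p dvd b \<and> q = of_int a / of_int b)"
proof
  assume "p_integral p q"
  then show "\<exists>a b. \<not> int p dvd b \<and> q = of_int a / of_int b"
    unfolding p_integral_def by (metis prod.collapse quotient_of_div)
next
  assume "\<exists>a b. \<not> int p dvd b \<and> q = of_int a / of_int b"
  then obtain a b where b: "\<not> int p dvd b" and q: "q = of_int a / of_int b" by blast
  obtain c e where ce: "quotient_of q = (c, e)" by fastforce
  have e: "e > 0" and cop: "coprime c e" and q': "q = of_int c / of_int e"
    using ce by (auto intro: quotient_of_denom_pos quotient_of_coprime quotient_of_div)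
  have "b \<noteq> 0" using b by auto
  then have "(of_int (c * b) :: rat) = of_int (a * e)"
    using q q' e by (simp add: field_simps)
  then have "c * b = a * e" by (simp only: of_int_eq_iff)
  then have "e dvd c * b" by simp
  then have "e dvd b" using cop by (simp add: coprime_commute coprime_dvd_mult_right_iff)
  then show "p_integral p q" unfolding p_integral_def ce using b dvd_trans by auto
qed

lemma p_unit_iff:
  "p_unit p q \<longleftrightarrow> p_integral p q \<and> q \<noteq> 0 \<and> p_integral p (inverse q)"
proof -
  obtain c e where ce: "quotient_of q = (c, e)" by fastforce
  have e: "e > 0" and cop: "coprime c e" and q': "q = of_int c / of_int e"
    using ce by (auto intro: quotient_of_denom_pos quotient_of_coprime quotient_of_div)
  have "\<not> int p dvd c \<longleftrightarrow> q \<noteq> 0 \<and> p_integral p (inverse q)"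
  proof
    assume c: "\<not> int p dvd c"
    then have "c \<noteq> 0" by auto
    moreover have "inverse q = of_int e / of_int c" using q' by simp
    ultimately show "q \<noteq> 0 \<and> p_integral p (inverse q)"
      using c e q' by (auto simp: p_integral_iff)
  next
    assume *: "q \<noteq> 0 \<and> p_integral p (inverse q)"
    then obtain a b where b: "\<not> int p dvd b" and q: "inverse q = of_int a / of_int b"
      by (auto simp: p_integral_iff)
    have "b \<noteq> 0" using b by auto
    moreover have "c \<noteq> 0" using * q' by auto
    moreover have "inverse q = of_int e / of_int c" using q' by simp
    ultimately have "of_int e / of_int c = (of_int a / of_int b :: rat)" using q by simp
    then have "(of_int (e * b) :: rat) = of_int (a * c)"
      using \<open>b \<noteq> 0\<close> \<open>c \<noteq> 0\<close> by (simp add: frac_eq_eq)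
    then have "e * b = a * c" by (simp only: of_int_eq_iff)
    then have "c dvd e * b" by simp
    then have "c dvd b" using cop by (simp add: coprime_dvd_mult_right_iff)
    then show "\<not> int p dvd c" using b dvd_trans by blast
  qed
  then show ?thesis by (simp add: p_unit_def ce)
qed

text \<open>Congruence in the localization of the integers at \<open>p\<close>. Integrality of both
  sides is built in, so congruences multiply and exponent 0 expresses integrality alone.\<close>

definition pcong :: "nat \<Rightarrow> nat \<Rightarrow> rat \<Rightarrow> rat \<Rightarrow> bool" where
  "pcong p k x y \<longleftrightarrow> p_integral p x \<and> p_integral p y \<and>
     (\<exists>t. p_integral p t \<and> x - y = of_nat p ^ k * t)"

lemma pcongD: "pcong p k x y \<Longrightarrow> p_integral p x" "pcong p k x y \<Longrightarrow> p_integral p y"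
  by (auto simp: pcong_def)

locale odd_prime =
  fixes p :: nat
  assumes prime: "prime p" and odd: "odd p"
begin

abbreviation "pint \<equiv> p_integral p"
abbreviation "punit \<equiv> p_unit p"
abbreviation "P \<equiv> (of_nat p :: rat)"

lemma p_ge_3: "p \<ge> 3"
  using prime odd prime_ge_2_nat[of p] by (cases "p = 2") auto

lemma prime_int_p: "prime (int p)"
  using prime by simp

lemma pint_of_int [simp]: "pint (of_int a)"
  unfolding p_integral_iff using prime_int_p
  by (intro exI[of _ a] exI[of _ 1]) (auto dest: not_prime_unit)

lemma pint_of_nat [simp]: "pint (of_nat a)"
  using pint_of_int[of "int a"] by simp

lemma pint_0 [simp]: "pint 0" and pint_1 [simp]: "pint 1" and pint_numeral [simp]: "pint (numeral n)"
  using pint_of_int[of 0] pint_of_int[of 1] pint_of_int[of "numeral n"] by simp_all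

lemma pint_add [simp]: assumes "pint x" "pint y" shows "pint (x + y)"
proof -
  obtain a b c e where *: "\<not> int p dvd b" "x = of_int a / of_int b"
    "\<not> int p dvd e" "y = of_int c / of_int e"
    using assms by (auto simp: p_integral_iff)
  then have "b \<noteq> 0" "e \<noteq> 0" by auto
  then have "x + y = of_int (a * e + c * b) / of_int (b * e)"
    using * by (simp add: field_simps)
  moreover have "\<not> int p dvd b * e"
    using * prime_int_p by (simp add: prime_dvd_mult_iff)
  ultimately show ?thesis unfolding p_integral_iff by blast
qed

lemma pint_mult [simp]: assumes "pint x" "pint y" shows "pint (x * y)"
proof -
  obtain a b c e where *: "\<not> int p dvd b" "x = of_int a / of_int b"
    "\<not> int p dvd e" "y = of_int c / of_int e"
    using assms by (auto simp: p_integral_iff)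
  then have "x * y = of_int (a * c) / of_int (b * e)"
    by simp
  moreover have "\<not> int p dvd b * e"
    using * prime_int_p by (simp add: prime_dvd_mult_iff)
  ultimately show ?thesis unfolding p_integral_iff by blast
qed

lemma pint_uminus [simp]: "pint x \<Longrightarrow> pint (- x)"
  using pint_mult[OF pint_of_int[of "-1"], of x] by simp

lemma pint_diff [simp]: "pint x \<Longrightarrow> pint y \<Longrightarrow> pint (x - y)"
  using pint_add[of x "- y"] by (simp del: pint_add)

lemma pint_power [simp]: "pint x \<Longrightarrow> pint (x ^ n)"
  by (induction n) auto

lemma pint_sum: "(\<And>i. i \<in> I \<Longrightarrow> pint (f i)) \<Longrightarrow> pint (sum f I)"
  by (induction I rule: infinite_finite_induct) auto

lemma punit_mult [simp]: "punit x \<Longrightarrow> punit y \<Longrightarrow> punit (x * y)"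
  by (auto simp: p_unit_iff)

lemma punit_1 [simp]: "punit 1"
  by (auto simp: p_unit_iff)

lemma punit_prod: "(\<And>i. i \<in> I \<Longrightarrow> punit (f i)) \<Longrightarrow> punit (prod f I)"
  by (induction I rule: infinite_finite_induct) auto

lemma punitD: "punit x \<Longrightarrow> pint x" "punit x \<Longrightarrow> x \<noteq> 0" "punit x \<Longrightarrow> pint (inverse x)"
  by (auto simp: p_unit_iff)

lemma pint_divide: "pint x \<Longrightarrow> punit y \<Longrightarrow> pint (x / y)"
  by (simp add: divide_inverse punitD)

lemma punit_inverse [simp]: "punit x \<Longrightarrow> punit (inverse x)"
  by (auto simp: p_unit_iff)

lemma punit_divide [simp]: "punit x \<Longrightarrow> punit y \<Longrightarrow> punit (x / y)"
  by (simp add: divide_inverse)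

lemma punit_of_int: assumes "\<not> int p dvd a" shows "punit (of_int a)"
proof -
  have "inverse (of_int a :: rat) = of_int 1 / of_int a" by (simp add: field_simps)
  then have "pint (inverse (of_int a))" using assms p_integral_iff by blast
  then show ?thesis unfolding p_unit_iff using assms by auto
qed

lemma punit_of_nat: "\<not> p dvd a \<Longrightarrow> punit (of_nat a)"
  using punit_of_int[of "int a"] by simp

lemma punit_2 [simp]: "punit 2"
  using punit_of_nat[of 2] p_ge_3 dvd_imp_le[of p 2] by auto

lemma pint_half [simp]: "pint (1/2)"
  by (rule pint_divide) auto

lemma pint_inverse_of_nat: "\<not> p dvd a \<Longrightarrow> pint (1 / of_nat a)"
  by (intro pint_divide punit_of_nat) auto

lemma pcong_refl: "pint x \<Longrightarrow> pcong p k x x"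
  unfolding pcong_def by (auto intro: exI[of _ 0])

lemma pcong_sym: "pcong p k x y \<Longrightarrow> pcong p k y x"
  unfolding pcong_def by (metis minus_diff_eq mult_minus_right pint_uminus)

lemma pcongI: "pint x \<Longrightarrow> pint y \<Longrightarrow> pint t \<Longrightarrow> x - y = P ^ k * t \<Longrightarrow> pcong p k x y"
  unfolding pcong_def by blast

lemma pcongE:
  assumes "pcong p k x y"
  obtains t where "pint t" "pint x" "pint y" "x = y + P ^ k * t"
  using assms unfolding pcong_def by (metis diff_add_cancel add.commute)

lemma pcong_trans [trans]: assumes "pcong p k x y" "pcong p k y z" shows "pcong p k x z"
proof -
  obtain t u where "pint t" "x = y + P ^ k * t" "pint u" "y = z + P ^ k * u"
    using assms by (metis pcongE)
  then show ?thesis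
    using assms by (intro pcongI[of _ _ "t + u"]) (auto simp: pcong_def algebra_simps)
qed

lemma eq_pcong_trans [trans]: "x = y \<Longrightarrow> pcong p k y z \<Longrightarrow> pcong p k x z"
  and pcong_eq_trans [trans]: "pcong p k x y \<Longrightarrow> y = z \<Longrightarrow> pcong p k x z"
  by simp_all

lemma pcong_add: assumes "pcong p k x y" "pcong p k z w" shows "pcong p k (x + z) (y + w)"
proof -
  obtain t u where "pint t" "x = y + P ^ k * t" "pint u" "z = w + P ^ k * u"
    using assms by (metis pcongE)
  then show ?thesis
    using assms by (intro pcongI[of _ _ "t + u"]) (auto simp: pcong_def algebra_simps)
qed

lemma pcong_mult: assumes "pcong p k x y" "pcong p k z w" shows "pcong p k (x * z) (y * w)"
proof -
  obtain t u where *: "pint t" "x = y + P ^ k * t" "pint u" "z = w + P ^ k * u"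
    using assms by (metis pcongE)
  have "x * z - y * w = P ^ k * (t * z + y * u)"
    using * by (simp add: algebra_simps)
  then show ?thesis
    using assms * by (intro pcongI[of _ _ "t * z + y * u"]) (auto simp: pcong_def)
qed

lemma pcong_diff: assumes "pcong p k x y" "pcong p k z w" shows "pcong p k (x - z) (y - w)"
  using pcong_add[OF assms(1) pcong_mult[OF pcong_refl[of "-1"] assms(2)]] by simp

lemma pcong_power: "pcong p k x y \<Longrightarrow> pcong p k (x ^ n) (y ^ n)"
  by (induction n) (auto intro: pcong_mult pcong_refl)

lemma pcong_sum: "(\<And>i. i \<in> I \<Longrightarrow> pcong p k (f i) (g i)) \<Longrightarrow> pcong p k (sum f I) (sum g I)"
  by (induction I rule: infinite_finite_induct) (auto intro: pcong_add pcong_refl)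

lemma pcong_prod: "(\<And>i. i \<in> I \<Longrightarrow> pcong p k (f i) (g i)) \<Longrightarrow> pcong p k (prod f I) (prod g I)"
  by (induction I rule: infinite_finite_induct) (auto intro: pcong_mult pcong_refl)

lemma pcong_0_iff: "pcong p 0 x y \<longleftrightarrow> pint x \<and> pint y"
  by (auto simp: pcong_def)

lemma pcong_mono: assumes "pcong p k x y" "j \<le> k" shows "pcong p j x y"
proof -
  obtain t where t: "pint t" "pint x" "pint y" "x = y + P ^ k * t" using assms by (metis pcongE)
  have "P ^ k = P ^ j * P ^ (k - j)" using assms by (simp flip: power_add)
  then show ?thesis using t by (intro pcongI[of _ _ "P ^ (k - j) * t"]) auto
qed

lemma pcong_divide:
  assumes "pcong p k x y" "pcong p k z w" "punit z" "punit w"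
  shows "pcong p k (x / z) (y / w)"
proof -
  obtain t u where *: "pint t" "x = y + P ^ k * t" "pint u" "z = w + P ^ k * u"
    using assms by (metis pcongE)
  have "x / z - y / w = P ^ k * ((t * w - y * u) / (z * w))"
    using punitD[OF assms(3)] punitD[OF assms(4)] * by (simp add: field_simps)
  moreover have "pint ((t * w - y * u) / (z * w))"
    using assms * by (intro pint_divide) (auto simp: punitD pcong_def)
  ultimately show ?thesis
    using assms by (intro pcongI[of _ _ "(t * w - y * u) / (z * w)"]) (auto simp: pcong_def pint_divide)
qed

text \<open>The localization is a local ring whose maximal ideal is generated by
  \<open>p\<close>.\<close>

lemma punit_iff_not_pcong: "pint x \<Longrightarrow> punit x \<longleftrightarrow> \<not> pcong p 1 x 0"
proof
  assume x: "punit x"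
  show "\<not> pcong p 1 x 0"
  proof
    assume "pcong p 1 x 0"
    then obtain t where t: "pint t" "x = P * t" by (elim pcongE) auto
    have "pint (t * inverse x)" using t(1) punitD(3)[OF x] by (rule pint_mult)
    moreover have "t * inverse x = 1 / P" using t punitD(2)[OF x] by (simp add: field_simps)
    ultimately obtain a b where ab: "\<not> int p dvd b" "1 / P = of_int a / of_int b"
      by (auto simp: p_integral_iff)
    then have "b \<noteq> 0" by auto
    then have "(of_int b :: rat) = of_int (a * int p)" using ab p_ge_3 by (simp add: field_simps)
    then have "b = a * int p" by (simp only: of_int_eq_iff)
    then show False using ab by simp
  qed
next
  assume x: "pint x" and n: "\<not> pcong p 1 x 0"
  obtain a b where ab: "\<not> int p dvd b" "x = of_int a / of_int b"
    using x by (auto simp: p_integral_iff)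
  have "\<not> int p dvd a"
  proof
    assume "int p dvd a"
    then obtain c where "a = int p * c" by blast
    then have "x - 0 = P ^ 1 * (of_int c / of_int b)" using ab by simp
    then show False using n x ab
      by (metis pcongI pint_0 p_integral_iff)
  qed
  then show "punit x" using ab by (simp add: punit_of_int)
qed

section \<open>Comparison with integer residues\<close>

lemma rat_cong_iff: "rat_cong p q a k \<longleftrightarrow> pcong p k q (of_int a)"
proof (cases "pint q")
  case True
  obtain n m where nm: "quotient_of q = (n, m)" by fastforce
  have m: "m > 0" and q: "q = of_int n / of_int m"
    using nm by (auto intro: quotient_of_denom_pos quotient_of_div)
  have pm: "\<not> int p dvd m" using True nm by (simp add: p_integral_def)
  have "[n = a * m] (mod int p ^ k) \<longleftrightarrow> pcong p k q (of_int a)"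
  proof
    assume "[n = a * m] (mod int p ^ k)"
    then obtain t where "n - a * m = int p ^ k * t" by (auto simp: cong_iff_dvd_diff)
    then have "(of_int (n - a * m) :: rat) = of_int (int p ^ k * t)" by (simp only:)
    then have "q - of_int a = P ^ k * (of_int t / of_int m)" using q m by (simp add: field_simps)
    moreover have "pint (of_int t / of_int m)" using pm by (auto simp: p_integral_iff)
    ultimately show "pcong p k q (of_int a)" using True by (intro pcongI) auto
  next
    assume "pcong p k q (of_int a)"
    then obtain t where t: "pint t" "q = of_int a + P ^ k * t" by (elim pcongE)
    then obtain c b where b: "\<not> int p dvd b" "t = of_int c / of_int b" by (auto simp: p_integral_iff)
    then have "b \<noteq> 0" by auto
    then have "(of_int ((n - a * m) * b) :: rat) = of_int (int p ^ k * (c * m))"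
      using t b m q by (simp add: field_simps)
    then have "(n - a * m) * b = int p ^ k * (c * m)" by (simp only: of_int_eq_iff)
    then have "int p ^ k dvd (n - a * m) * b" by simp
    moreover have "coprime (int p ^ k) b"
      using b prime_int_p by (simp add: prime_imp_coprime)
    ultimately show "[n = a * m] (mod int p ^ k)"
      by (simp add: cong_iff_dvd_diff coprime_dvd_mult_left_iff)
  qed
  then show ?thesis using True nm by (simp add: rat_cong_def)
next
  case False
  then show ?thesis by (auto simp: rat_cong_def pcong_def)
qed

lemma pcong_of_int_iff: "pcong p k (of_int a) (of_int b) \<longleftrightarrow> [a = b] (mod int p ^ k)"
  unfolding rat_cong_iff[symmetric] using pint_of_int[of a] by (simp add: rat_cong_def)

text \<open>A denominator prime to \<open>p\<close> is invertible modulo \<open>p^k\<close>. These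
  residues become the components of the limit.\<close>

lemma ex_residue: assumes "pint q" shows "\<exists>a. 0 \<le> a \<and> a < int p ^ k \<and> pcong p k q (of_int a)"
proof -
  obtain n m where nm: "\<not> int p dvd m" "q = of_int n / of_int m"
    using assms by (auto simp: p_integral_iff)
  have "coprime m (int p ^ k)"
    using prime_imp_coprime[OF prime_int_p nm(1)] by (simp add: coprime_commute)
  then obtain b where b: "[m * b = 1] (mod int p ^ k)"
    using cong_solve_coprime_int by blast
  define a where "a = n * b mod int p ^ k"
  have "[a = n * b] (mod int p ^ k)" by (simp add: a_def cong_def)
  then have "[a * m = n * b * m] (mod int p ^ k)" by (rule cong_scalar_right)
  also have "n * b * m = n * (m * b)" by (simp add: mult_ac)
  also have "[n * (m * b) = n * 1] (mod int p ^ k)" using b by (rule cong_scalar_left)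
  finally have "pcong p k (of_int (a * m)) (of_int n)"
    unfolding pcong_of_int_iff by simp
  then have "pcong p k (of_int n) (of_int (a * m))" by (rule pcong_sym)
  then have "pcong p k (of_int n / of_int m) (of_int (a * m) / of_int m)"
    using nm by (intro pcong_divide pcong_refl punit_of_int) auto
  moreover have "m \<noteq> 0" using nm by auto
  ultimately have "pcong p k q (of_int a)" using nm by simp
  moreover have "int p ^ k > 0" using p_ge_3 by simp
  ultimately show ?thesis unfolding a_def
    by (meson pos_mod_bound pos_mod_sign)
qed

end

section \<open>The transfer operator\<close>

context odd_prime
begin

text \<open>The 1-Lipschitz condition for the p-adic metric on the naturals; its case k = 0 carries
  the integrality of all values.\<close>

definition lip :: "(nat \<Rightarrow> rat) \<Rightarrow> bool" where
  "lip g \<longleftrightarrow> (\<forall>k n m. pcong p k (g (n + p ^ k * m)) (g n))"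

lemma lipD: "lip g \<Longrightarrow> pcong p k (g (n + p ^ k * m)) (g n)"
  by (simp add: lip_def)

lemma lip_pint: "lip g \<Longrightarrow> pint (g n)"
  using lipD[of g 0 n 0] by (simp add: pcong_0_iff)

lemma lip_const: "pint c \<Longrightarrow> lip (\<lambda>n. c)"
  by (simp add: lip_def pcong_refl)

lemma lip_mult: "lip f \<Longrightarrow> lip g \<Longrightarrow> lip (\<lambda>n. f n * g n)"
  by (simp add: lip_def pcong_mult)

lemma lip_power: "lip f \<Longrightarrow> lip (\<lambda>n. f n ^ d)"
  by (simp add: lip_def pcong_power)

lemma pcong_P_mult_cancel:
  assumes "pcong p (Suc k) (P * x) (P * y)" "pint x" "pint y" shows "pcong p k x y"
proof -
  obtain t where t: "pint t" "P * x = P * y + P ^ Suc k * t" using assms by (metis pcongE)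
  then have "P * (x - y) = P * (P ^ k * t)" by (simp add: algebra_simps)
  then have "x - y = P ^ k * t" using p_ge_3 by simp
  then show ?thesis using assms t by (intro pcongI)
qed

lemma pcong_P_mult:
  assumes "pcong p k x y" shows "pcong p (Suc k) (P * x) (P * y)"
proof -
  obtain t where "pint t" "pint x" "pint y" "x = y + P ^ k * t" using assms by (metis pcongE)
  then show ?thesis by (intro pcongI[of _ _ t]) (auto simp: algebra_simps)
qed

end

locale dwork_sequence = odd_prime +
  fixes A R :: "nat \<Rightarrow> rat"
  assumes A_0: "A 0 = 1"
    and A_rec: "A n = R n * A (n div p)"
    and lip_R: "lip R"
begin

text \<open>The points \<open>a + p * m\<close> are the preimages of \<open>m\<close> under division
  by \<open>p\<close>: this is the transfer operator of the digit shift with weight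
  \<open>R\<close>.\<close>

definition T :: "(nat \<Rightarrow> rat) \<Rightarrow> nat \<Rightarrow> rat" where
  "T g m = (\<Sum>a<p. R (a + p * m) * g (a + p * m))"

definition S :: "nat \<Rightarrow> (nat \<Rightarrow> rat) \<Rightarrow> rat" where
  "S s g = (\<Sum>n<p ^ s. A n * g n)"

lemma sum_lessThan_mult:
  "(\<Sum>n<p * N. f n) = (\<Sum>m<N. \<Sum>a<p. f (a + p * m :: nat))" for f :: "nat \<Rightarrow> rat"
proof (induction N)
  case (Suc N)
  have "(\<Sum>n<p * N + p. f n) = (\<Sum>n<p * N. f n) + (\<Sum>n\<in>{p * N..<p * N + p}. f n)"
    by (simp add: lessThan_atLeast0 sum.atLeastLessThan_concat)
  also have "(\<Sum>n\<in>{p * N..<p * N + p}. f n) = (\<Sum>a<p. f (a + p * N))"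
    using sum.shift_bounds_nat_ivl[of f 0 "p * N" p] by (simp add: lessThan_atLeast0 add.commute)
  finally show ?case using Suc by (simp add: add.commute)
qed simp

lemma S_0: "S 0 g = g 0"
  by (simp add: S_def A_0)

text \<open>Grouping the indices by their quotient m by \<open>p\<close>, \<open>A_rec\<close> pulls
  out \<open>A m\<close> and leaves \<open>T g m\<close> as the inner sum.\<close>

lemma S_Suc: "S (Suc s) g = S s (T g)"
proof -
  have "S (Suc s) g = (\<Sum>m<p ^ s. \<Sum>a<p. A (a + p * m) * g (a + p * m))"
    by (simp add: S_def sum_lessThan_mult)
  also have "\<dots> = (\<Sum>m<p ^ s. \<Sum>a<p. A m * (R (a + p * m) * g (a + p * m)))"
    by (intro sum.cong refl) (subst A_rec, simp)
  finally show ?thesis by (simp add: S_def T_def sum_distrib_left)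
qed

lemma S_linear: "S s (\<lambda>n. c * f n + e * g n) = c * S s f + e * S s g"
  by (simp add: S_def sum.distrib sum_distrib_left algebra_simps)

text \<open>Shifting the argument of \<open>T g\<close> by a multiple of \<open>p^k\<close> shifts
  each \<open>a + p * m\<close> by a multiple of \<open>p^(k+1)\<close>, so \<open>T g\<close> is
  one power of \<open>p\<close> better than \<open>g\<close>. The factor \<open>1\<close> matches
  the pattern of \<open>S_linear\<close>.\<close>

lemma T_lip:
  assumes "lip g"
  obtains h where "lip h" "\<And>m. T g m = T g 0 * 1 + P * h m" "pint (T g 0)"
proof -
  have T: "pcong p (Suc k) (T g (n + p ^ k * m)) (T g n)" for k n m
  proof -
    have "a + p * (n + p ^ k * m) = (a + p * n) + p ^ Suc k * m" for a
      by (simp add: algebra_simps)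
    then show ?thesis unfolding T_def
      by (simp only:) (intro pcong_sum lipD[OF lip_mult[OF lip_R assms], of "Suc k"])
  qed
  define h where "h m = (T g m - T g 0) / P" for m
  have Tg: "T g m = T g 0 + P * h m" for m using p_ge_3 by (simp add: h_def)
  have T0: "pint (T g 0)" using T[of 0] by (auto simp: pcong_def)
  have int: "pint (h m)" for m
  proof -
    have "pcong p 1 (T g m) (T g 0)" using T[of 0 0 m] by simp
    then obtain t where "pint t" "T g m = T g 0 + P * t" by (elim pcongE) auto
    then show ?thesis using p_ge_3 by (simp add: h_def)
  qed
  have "lip h" unfolding lip_def
  proof (intro allI)
    fix k n m
    have "pcong p (Suc k) (T g (n + p ^ k * m) - T g 0) (T g n - T g 0)"
      by (intro pcong_diff pcong_refl T T0)
    then have "pcong p (Suc k) (P * h (n + p ^ k * m)) (P * h n)"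
      using p_ge_3 by (simp add: h_def)
    then show "pcong p k (h (n + p ^ k * m)) (h n)"
      by (rule pcong_P_mult_cancel[OF _ int int])
  qed
  moreover have "T g m = T g 0 * 1 + P * h m" for m using Tg[of m] by (simp only: mult_1_right)
  ultimately show ?thesis using T0 by (rule that)
qed

section \<open>Exterior square and Dwork's congruence\<close>

definition wedge :: "nat \<Rightarrow> (nat \<Rightarrow> rat) \<Rightarrow> (nat \<Rightarrow> rat) \<Rightarrow> rat" where
  "wedge k f g = S k f * S (Suc k) g - S k g * S (Suc k) f"

text \<open>As a 2 by 2 determinant, \<open>wedge\<close> is bilinear and alternating: the term from
  the two constants vanishes and every other term has a factor \<open>P\<close>.\<close>

lemma wedge_expand:
  assumes "\<And>m. f m = a * 1 + P * f' m" "\<And>m. g m = b * 1 + P * g' m"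
  shows "wedge k f g = P * (a * wedge k (\<lambda>_. 1) g' - b * wedge k (\<lambda>_. 1) f' + P * wedge k f' g')"
proof -
  have "f = (\<lambda>m. a * 1 + P * f' m)" "g = (\<lambda>m. b * 1 + P * g' m)" using assms by auto
  then show ?thesis by (simp only: wedge_def S_linear) (simp add: algebra_simps)
qed

lemma pint_S: "lip g \<Longrightarrow> pint (S s g)"
proof (induction s arbitrary: g)
  case (Suc s)
  obtain h where h: "lip h" "\<And>m. T g m = T g 0 * 1 + P * h m" "pint (T g 0)"
    using T_lip[OF Suc.prems] by blast
  then have "T g = (\<lambda>m. T g 0 * 1 + P * h m)" by blast
  then have "S s (T g) = S s (\<lambda>m. T g 0 * 1 + P * h m)" by (rule arg_cong)
  then have "S (Suc s) g = T g 0 * S s (\<lambda>_. 1) + P * S s h"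
    by (simp only: S_Suc S_linear)
  then show ?case using Suc.IH[OF h(1)] Suc.IH[OF lip_const[OF pint_1]] h(3) by simp
qed (simp add: S_0 lip_pint)

text \<open>Applying \<open>T\<close> to both arguments lowers the index of \<open>wedge\<close> by
  one and, through \<open>T_lip\<close>, releases a factor \<open>p\<close>.\<close>

lemma pcong_wedge: "lip f \<Longrightarrow> lip g \<Longrightarrow> pcong p k (wedge k f g) 0"
proof (induction k arbitrary: f g)
  case 0
  then show ?case by (simp add: pcong_0_iff wedge_def pint_S)
next
  case (Suc k)
  obtain f' where f: "lip f'" "\<And>m. T f m = T f 0 * 1 + P * f' m" "pint (T f 0)"
    using T_lip[OF Suc.prems(1)] by blast
  obtain g' where g: "lip g'" "\<And>m. T g m = T g 0 * 1 + P * g' m" "pint (T g 0)"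
    using T_lip[OF Suc.prems(2)] by blast
  note 1 = lip_const[OF pint_1]
  have "wedge (Suc k) f g = wedge k (T f) (T g)"
    by (simp only: wedge_def S_Suc)
  also have "\<dots> = P * (T f 0 * wedge k (\<lambda>_. 1) g' - T g 0 * wedge k (\<lambda>_. 1) f' + P * wedge k f' g')"
    by (rule wedge_expand[OF f(2) g(2)])
  finally have eq: "wedge (Suc k) f g = \<dots>" .
  have "pcong p k (T f 0 * wedge k (\<lambda>_. 1) g' - T g 0 * wedge k (\<lambda>_. 1) f' + P * wedge k f' g')
     (T f 0 * 0 - T g 0 * 0 + P * 0)"
    using f(1,3) g(1,3) 1 by (intro pcong_add pcong_diff pcong_mult pcong_refl Suc.IH) auto
  from pcong_P_mult[OF this] show ?case by (simp only: eq mult_zero_right diff_self add_0)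
qed

text \<open>The difference of the two sides is \<open>wedge k\<close> of the constant 1 and its
  image under \<open>T\<close>. \<open>pcong_wedge\<close> alone yields \<open>p^k\<close>; the
  additional factor appears because the constant part of that image drops out against 1.\<close>

theorem dwork_congruence:
  "pcong p (Suc k) (S (Suc (Suc k)) (\<lambda>_. 1) * S k (\<lambda>_. 1)) (S (Suc k) (\<lambda>_. 1) ^ 2)"
proof -
  note 1 = lip_const[OF pint_1]
  obtain h where h: "lip h" "\<And>m. T (\<lambda>_. 1) m = T (\<lambda>_. 1) 0 * 1 + P * h m" "pint (T (\<lambda>_. 1) 0)"
    using T_lip[OF 1] by blast
  have "wedge k (\<lambda>_. 1) (T (\<lambda>_. 1)) = P * wedge k (\<lambda>_. 1) h"
    \<comment> \<open>The function 1 is split as \<open>1 * 1 + P * 0\<close>.\<close>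
    using wedge_expand[of "\<lambda>_. 1" 1 "\<lambda>_. 0", OF _ h(2), of k] by (simp add: wedge_def S_def)
  then have "pcong p (Suc k) (wedge k (\<lambda>_. 1) (T (\<lambda>_. 1))) 0"
    using pcong_P_mult[OF pcong_wedge[OF 1 h(1), of k]] by simp
  moreover have "wedge k (\<lambda>_. 1) (T (\<lambda>_. 1)) =
      S (Suc (Suc k)) (\<lambda>_. 1) * S k (\<lambda>_. 1) - S (Suc k) (\<lambda>_. 1) ^ 2"
    by (simp add: wedge_def S_Suc power2_eq_square)
  ultimately have *: "pcong p (Suc k) (S (Suc (Suc k)) (\<lambda>_. 1) * S k (\<lambda>_. 1) - S (Suc k) (\<lambda>_. 1) ^ 2) 0"
    by simp
  show ?thesis
    using pcong_add[OF * pcong_refl[of "S (Suc k) (\<lambda>_. 1) ^ 2"]] by (simp add: pint_S[OF 1])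
qed

section \<open>Units and the limit of the quotients\<close>

abbreviation F :: "nat \<Rightarrow> rat" where "F s \<equiv> S s (\<lambda>_. 1)"

lemma pint_F: "pint (F s)"
  by (rule pint_S[OF lip_const[OF pint_1]])

text \<open>If \<open>F (s + 2)\<close> were divisible by \<open>p\<close>, then by Dwork's
  congruence so would be the square of the unit \<open>F (s + 1)\<close>.\<close>

lemma punit_F:
  assumes "punit (F 1)" shows "punit (F s)"
proof -
  have "punit (F s) \<and> punit (F (Suc s))"
  proof (induction s)
    case 0
    then show ?case using assms by (simp add: S_0)
  next
    case (Suc s)
    have "\<not> pcong p 1 (F (Suc (Suc s))) 0"
    proof
      assume "pcong p 1 (F (Suc (Suc s))) 0"
      then have "pcong p 1 (F (Suc (Suc s)) * F s) (0 * F s)"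
        by (intro pcong_mult pcong_refl pint_F)
      then have "pcong p 1 (F (Suc s) ^ 2) 0"
        using pcong_trans[OF pcong_sym[OF pcong_mono[OF dwork_congruence, of 1]]] by simp
      moreover have "punit (F (Suc s) ^ 2)" using Suc by (simp add: power2_eq_square)
      ultimately show False using punit_iff_not_pcong punitD(1) by blast
    qed
    then show ?case using Suc punit_iff_not_pcong pint_F by blast
  qed
  then show ?thesis ..
qed

text \<open>Dividing Dwork's congruence by units makes consecutive quotients agree modulo
  \<open>p^s\<close>; chaining from \<open>k\<close> upward keeps agreement modulo
  \<open>p^k\<close>.\<close>

lemma F_quotient_cong:
  assumes "punit (F 1)" "k \<le> s"
  shows "pcong p k (F s / F (s - 1)) (F k / F (k - 1))"
  using assms(2)
proof (induction s rule: dec_induct)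
  case base
  then show ?case by (intro pcong_refl pint_divide pint_F punit_F[OF assms(1)])
next
  case (step s)
  note u = punit_F[OF assms(1)]
  have "pcong p s (F (Suc s) / F s) (F s / F (s - 1))"
  proof (cases s)
    \<comment> \<open>Here \<open>s - 1\<close> is again 0, and a congruence modulo
      \<open>p^0\<close> asks only for integrality.\<close>
    case 0
    then show ?thesis by (simp add: pcong_0_iff pint_divide pint_F u)
  next
    case (Suc n)
    have "pcong p s (F (Suc s) * F n / (F s * F n)) (F s ^ 2 / (F s * F n))"
      unfolding Suc by (intro pcong_divide dwork_congruence pcong_refl) (auto simp: pint_F u)
    moreover have "F n \<noteq> 0" "F s \<noteq> 0" using punitD(2)[OF u] by auto
    ultimately show ?thesis using Suc by (simp add: power2_eq_square)
  qed
  then have "pcong p k (F (Suc s) / F s) (F s / F (s - 1))"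
    using step.hyps(1) by (rule pcong_mono)
  from pcong_trans[OF this step.IH] show ?case by simp
qed

text \<open>Modulo \<open>p^k\<close> the quotients are constant from the \<open>k\<close>-th on, so
  its residue can serve as \<open>f k\<close>. The last conjunct ties \<open>f 2\<close> directly to
  \<open>F 2 / F 1\<close>.\<close>

lemma F_quotient_limit:
  assumes "punit (F 1)"
  shows "\<exists>f. Zp p f \<and> padic_tendsto p (\<lambda>s. F s / F (s - 1)) f \<and>
    (\<forall>k. pcong p k (F k / F (k - 1)) (of_int (f k)))"
proof -
  have "\<forall>k. \<exists>a. 0 \<le> a \<and> a < int p ^ k \<and> pcong p k (F k / F (k - 1)) (of_int a)"
    by (intro allI ex_residue pint_divide pint_F punit_F[OF assms])
  then obtain f where f: "\<And>k. 0 \<le> f k" "\<And>k. f k < int p ^ k"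
      "\<And>k. pcong p k (F k / F (k - 1)) (of_int (f k))"
    by metis
  have lim: "pcong p k (F s / F (s - 1)) (of_int (f k))" if "k \<le> s" for k s
    using pcong_trans[OF F_quotient_cong[OF assms that] f(3)] .
  have "f (Suc k) mod int p ^ k = f k" for k
  proof -
    have "pcong p k (of_int (f (Suc k))) (of_int (f k))"
      using pcong_trans[OF pcong_sym[OF pcong_mono[OF f(3)[of "Suc k"], of k]] lim[of k "Suc k"]]
      by simp
    then show ?thesis using f(1,2)[of k] by (simp add: pcong_of_int_iff cong_def)
  qed
  then have "Zp p f" using f by (simp add: Zp_def)
  moreover have "padic_tendsto p (\<lambda>s. F s / F (s - 1)) f"
    unfolding padic_tendsto_def rat_cong_iff eventually_sequentially using lim by blast
  ultimately show ?thesis using f(3) by blast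
qed

text \<open>\<open>F 2\<close> is the sum over n < p of \<open>A n\<close> times the value at n of
  \<open>T\<close> applied to 1. Replacing each value by the one at 0, which is \<open>F 1\<close>,
  leaves \<open>F 1\<close> squared.\<close>

lemma F_2_cong:
  assumes "\<And>m. pcong p 2 (T (\<lambda>_. 1) m) c"
  shows "pcong p 2 (F 2) (F 1 ^ 2)"
proof -
  have A: "pint (A n)" if "n < p" for n
    using A_rec[of n] that lip_pint[OF lip_R] by (simp add: A_0)
  have F1: "F 1 = T (\<lambda>_. 1) 0" using S_Suc[of 0] by (simp add: S_0)
  have "F 2 = (\<Sum>n<p. A n * T (\<lambda>_. 1) n)"
    using S_Suc[of 1 "\<lambda>_. 1"] by (simp add: S_def numeral_2_eq_2)
  also have "pcong p 2 \<dots> (\<Sum>n<p. A n * F 1)"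
    unfolding F1 using A by (intro pcong_sum pcong_mult pcong_refl)
      (auto intro: pcong_trans[OF assms pcong_sym[OF assms]])
  also have "(\<Sum>n<p. A n * F 1) = F 1 ^ 2"
    by (simp add: S_def power2_eq_square sum_distrib_right)
  finally show ?thesis .
qed

end

section \<open>The sequence \<open>alpha\<close>\<close>

context odd_prime
begin

definition h :: nat where "h = p div 2"

lemma p_eq: "2 * h + 1 = p"
  using odd unfolding h_def by presburger

lemma P_eq: "P = 2 * of_nat h + 1"
  using arg_cong[OF p_eq, of "of_nat :: nat \<Rightarrow> rat"] by simp

lemma h_pos: "h \<ge> 1"
  using p_ge_3 p_eq by linarith

section \<open>Products with the multiples of p removed\<close>

definition num :: "nat \<Rightarrow> rat" where
  "num j = (if p dvd 2 * j + 1 then 1 else 1/2 + of_nat j)"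

definition den :: "nat \<Rightarrow> rat" where
  "den j = (if p dvd j + 1 then 1 else of_nat (j + 1))"

definition w :: "nat \<Rightarrow> rat" where "w j = num j / den j"

text \<open>In the manner of Morita's p-adic Gamma function: \<open>alpha n\<close> with all
  numerator and denominator factors divisible by \<open>p\<close> replaced by 1.\<close>

definition U :: "nat \<Rightarrow> rat" where "U n = (\<Prod>j<n. w j)"

lemma num_eq: "\<not> p dvd 2 * j + 1 \<Longrightarrow> num j = of_nat (2 * j + 1) / 2"
  by (simp add: num_def field_simps)

lemma punit_num [simp]: "punit (num j)"
proof (cases "p dvd 2 * j + 1")
  case False
  show ?thesis unfolding num_eq[OF False] by (intro punit_divide punit_of_nat False punit_2)
qed (simp add: num_def)

lemma punit_den [simp]: "punit (den j)"
  unfolding den_def using punit_of_nat[of "j + 1"] by simp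

lemma punit_w [simp]: "punit (w j)" and punit_U [simp]: "punit (U n)"
  by (auto simp: w_def U_def intro!: punit_prod)

lemma U_0 [simp]: "U 0 = 1" and U_Suc: "U (Suc n) = U n * w n"
  by (simp_all add: U_def)

lemma U_add: "U (n + N) = U N * (\<Prod>j<n. w (j + N))"
  by (induction n) (auto simp: U_Suc)

lemma pcong_of_nat_shift: "pcong p k (of_nat (a + p ^ k * m)) (of_nat a)"
  by (rule pcongI[of _ _ "of_nat m"]) (simp_all del: of_nat_add, simp)

lemma dvd_shift:
  assumes "k \<ge> 1" shows "p dvd 2 * (j + p ^ k * m) + 1 \<longleftrightarrow> p dvd 2 * j + 1"
    "p dvd (j + p ^ k * m) + 1 \<longleftrightarrow> p dvd j + 1"
proof -
  have "p dvd p ^ k * m" "p dvd 2 * (p ^ k * m)" using assms by (auto intro!: dvd_mult dvd_mult2)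
  then show "p dvd 2 * (j + p ^ k * m) + 1 \<longleftrightarrow> p dvd 2 * j + 1"
    "p dvd (j + p ^ k * m) + 1 \<longleftrightarrow> p dvd j + 1"
    using dvd_add_left_iff[of p "2 * (p ^ k * m)" "2 * j + 1"] dvd_add_left_iff[of p "p ^ k * m" "j + 1"]
    by (simp_all add: algebra_simps)
qed

lemma num_shift: assumes "k \<ge> 1" shows "pcong p k (num (j + p ^ k * m)) (num j)"
  using pcong_add[OF pcong_refl[of "1/2"] pcong_of_nat_shift[of k j m]] dvd_shift[OF assms, of j m]
  unfolding num_def by (simp add: pcong_refl)

lemma den_shift: assumes "k \<ge> 1" shows "pcong p k (den (j + p ^ k * m)) (den j)"
  using pcong_of_nat_shift[of k "j + 1" m] dvd_shift(2)[OF assms, of j m]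
  unfolding den_def by (simp add: pcong_refl add_ac)

lemma w_shift: "k \<ge> 1 \<Longrightarrow> pcong p k (w (j + p ^ k * m)) (w j)"
  unfolding w_def by (intro pcong_divide num_shift den_shift) auto

text \<open>Moving the window by one trades \<open>f b\<close> for the congruent
  \<open>f (b + N)\<close>.\<close>

lemma prod_periodic:
  fixes N :: nat
  assumes "\<And>j. pcong p k (f (j + N)) (f j)"
  shows "pcong p k (\<Prod>j<N. f (j + b)) (\<Prod>j<N. f j)"
proof (cases N)
  case (Suc n)
  have int: "pint (f j)" for j using assms by (rule pcongD)
  show ?thesis
  proof (induction b)
    case 0
    show ?case by (simp only: add_0_right) (intro pcong_prod pcong_refl int)
  next
    case (Suc b)
    have "(\<Prod>j<N. f (j + Suc b)) = (\<Prod>j<n. f (j + Suc b)) * f (b + N)"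
      by (simp add: \<open>N = Suc n\<close> add_ac)
    also have "pcong p k \<dots> ((\<Prod>j<n. f (j + Suc b)) * f b)"
      using int by (intro pcong_mult assms pcong_prod pcong_refl) auto
    also have "(\<Prod>j<n. f (j + Suc b)) * f b = (\<Prod>j<N. f (j + b))"
      by (simp only: \<open>N = Suc n\<close> prod.lessThan_Suc_shift) (simp add: mult.commute)
    also have "pcong p k \<dots> (\<Prod>j<N. f j)" by (rule Suc.IH)
    finally show ?case .
  qed
qed (simp add: pcong_refl)

text \<open>Modulo \<open>N = p^k\<close> the numerator \<open>1/2 + j\<close> is the integer \<open>j + (N + 1)/2\<close>, so numerator and
  denominator both run once through the units.\<close>

lemma U_prime_power: assumes "k \<ge> 1" shows "pcong p k (U (p ^ k)) 1"
proof -
  define N where "N = p ^ k"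
  define b where "b = N div 2"
  have "odd N" unfolding N_def using odd by simp
  then have N: "N = 2 * b + 1" unfolding b_def by presburger
  have num_den: "pcong p k (num j) (den (j + b))" for j
  proof -
    have "p dvd N" using assms by (simp add: N_def)
    \<comment> \<open>The factors replaced by 1 correspond: adding \<open>N\<close> turns
      \<open>2 * j + 1\<close> into twice \<open>j + b + 1\<close>, and 2 is prime to
      \<open>p\<close>.\<close>
    then have "p dvd 2 * j + 1 \<longleftrightarrow> p dvd (2 * j + 1) + N" by (metis dvd_add_left_iff)
    also have "(2 * j + 1) + N = 2 * (j + b + 1)" using N by simp
    also have "p dvd \<dots> \<longleftrightarrow> p dvd j + b + 1"
      using prime p_ge_3 dvd_imp_le[of p 2] by (auto simp: prime_dvd_mult_iff simp del: mult_Suc_right)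
    finally have iff: "p dvd 2 * j + 1 \<longleftrightarrow> p dvd j + b + 1" .
    have "(of_nat N :: rat) = 2 * of_nat b + 1" by (subst N) simp
    then have "(1/2 + of_nat j) - of_nat (j + b + 1) = P ^ k * (- (1/2))"
      by (simp add: N_def field_simps)
    then have "pcong p k (1/2 + of_nat j) (of_nat (j + b + 1))"
      by (intro pcongI[of _ _ "- (1/2)"] pint_uminus pint_add) (auto simp del: of_nat_add)
    then show ?thesis using iff by (auto simp: num_def den_def pcong_refl)
  qed
  have "pcong p k (\<Prod>j<N. num j) (\<Prod>j<N. den (j + b))"
    by (intro pcong_prod num_den)
  also have "pcong p k \<dots> (\<Prod>j<N. den j)"
    using den_shift[OF assms, of _ 1] by (intro prod_periodic) (simp add: N_def)
  finally have "pcong p k ((\<Prod>j<N. num j) / (\<Prod>j<N. den j)) ((\<Prod>j<N. den j) / (\<Prod>j<N. den j))"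
    by (intro pcong_divide pcong_refl) (auto intro!: punit_prod punitD(1))
  moreover have "(\<Prod>j<N. den j) \<noteq> 0" by (rule punitD(2)) (auto intro!: punit_prod)
  ultimately show ?thesis unfolding N_def[symmetric]
    by (simp add: U_def w_def prod_dividef)
qed

lemma U_shift: assumes "k \<ge> 1" shows "pcong p k (U (n + p ^ k * m)) (U n)"
proof -
  have "pcong p k (U (p ^ k * m)) 1"
  proof (induction m)
    case (Suc m)
    have "U (p ^ k * Suc m) = U (p ^ k * m) * (\<Prod>j<p ^ k. w (j + p ^ k * m))"
      using U_add[of "p ^ k" "p ^ k * m"] by simp
    also have "pcong p k \<dots> (1 * (\<Prod>j<p ^ k. w j))"
      using assms by (intro pcong_mult Suc.IH pcong_prod w_shift)
    also have "1 * (\<Prod>j<p ^ k. w j) = U (p ^ k)" by (simp add: U_def)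
    also have "pcong p k \<dots> 1" using assms by (rule U_prime_power)
    finally show ?case .
  qed (simp add: pcong_refl)
  then have "pcong p k (U (p ^ k * m) * (\<Prod>j<n. w (j + p ^ k * m))) (1 * (\<Prod>j<n. w j))"
    using assms by (intro pcong_mult pcong_prod w_shift)
  then show ?thesis by (simp add: U_add) (simp add: U_def)
qed

text \<open>The ratio of \<open>alpha n\<close> to \<open>alpha (n div p)\<close>. The numerator
  factors divisible by \<open>p\<close> are \<open>P * (1/2 + i)\<close>, at index
  \<open>h + p * i\<close>, and the denominator ones are \<open>P * (i + 1)\<close>. They account
  for \<open>alpha (n div p)\<close>, with one extra numerator factor when the last digit exceeds
  \<open>h\<close>.\<close>

definition u :: "nat \<Rightarrow> rat" where
  "u n = U n * (if n mod p > h then P * (1/2 + of_nat (n div p)) else 1)"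

lemma pint_u: "pint (u n)"
  unfolding u_def using punitD(1)[OF punit_U] by (intro pint_mult) auto

lemma lip_u: "lip u"
  unfolding lip_def
proof (intro allI)
  fix k n m
  show "pcong p k (u (n + p ^ k * m)) (u n)"
  proof (cases k)
    case 0
    then show ?thesis by (simp add: pcong_0_iff pint_u)
  next
    case (Suc l)
    have m: "(n + p ^ k * m) mod p = n mod p" using Suc by (simp add: mult.assoc)
    have d: "(n + p ^ k * m) div p = n div p + p ^ l * m"
      using Suc p_ge_3 by (simp add: mult.assoc)
    \<comment> \<open>The quotient by \<open>p\<close> is controlled only modulo \<open>p^l\<close>,
      one power short; the factor \<open>P\<close> makes up for it.\<close>
    have "pcong p l (1/2 + of_nat (n div p + p ^ l * m)) (1/2 + of_nat (n div p))"
      by (intro pcong_add pcong_of_nat_shift pcong_refl) auto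
    then have "pcong p k (P * (1/2 + of_nat ((n + p ^ k * m) div p))) (P * (1/2 + of_nat (n div p)))"
      unfolding d unfolding Suc by (rule pcong_P_mult)
    then show ?thesis unfolding u_def m using Suc
      by (intro pcong_mult U_shift) (auto intro: pcong_refl)
  qed
qed

section \<open>Recursion along the last base-p digit\<close>

lemma alpha_0: "alpha 0 = 1" and alpha_Suc: "alpha (Suc n) = alpha n * ((1/2 + of_nat n) / of_nat (Suc n))"
  by (simp_all add: alpha_def pochhammer_Suc)

lemma dvd_num_iff: "p dvd 2 * (a + p * m) + 1 \<longleftrightarrow> a = h" if "a < p"
proof -
  have "p dvd 2 * (a + p * m) + 1 \<longleftrightarrow> p dvd (2 * a + 1) + p * (2 * m)" by (simp add: algebra_simps)
  also have "\<dots> \<longleftrightarrow> p dvd 2 * a + 1" by (subst dvd_add_left_iff) auto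
  also have "\<dots> \<longleftrightarrow> a = h"
  proof
    assume "p dvd 2 * a + 1"
    then obtain c where c: "2 * a + 1 = p * c" by blast
    have "p * c < p * 2" using that c p_eq by linarith
    then have "c < 2" by simp
    moreover have "c \<noteq> 0" using c by (intro notI) simp
    ultimately have "c = 1" by linarith
    then show "a = h" using c p_eq by simp
  next
    assume "a = h" then show "p dvd 2 * a + 1" using p_eq by simp
  qed
  finally show ?thesis .
qed

lemma dvd_den_iff: "p dvd a + p * m + 1 \<longleftrightarrow> a = p - 1" if "a < p"
proof -
  have "p dvd a + p * m + 1 \<longleftrightarrow> p dvd (a + 1) + p * m" by (simp add: algebra_simps)
  also have "\<dots> \<longleftrightarrow> p dvd a + 1" by (subst dvd_add_left_iff) auto
  also have "\<dots> \<longleftrightarrow> a = p - 1" using that dvd_imp_le[of p "a + 1"] by auto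
  finally show ?thesis .
qed

text \<open>The step from n to n + 1 is generic except at last digit \<open>h\<close>, where a
  numerator factor divisible by \<open>p\<close> appears, and at \<open>p - 1\<close>, where a
  denominator factor divisible by \<open>p\<close> appears and the quotient by \<open>p\<close>
  increases.\<close>

lemma alpha_rec: "alpha n = u n * alpha (n div p)"
proof (induction n)
  case 0
  then show ?case by (simp add: u_def)
next
  case (Suc n)
  define a m where "a = n mod p" and "m = n div p"
  have a: "a < p" using p_ge_3 by (simp add: a_def)
  have n: "n = a + p * m" by (simp add: a_def m_def)
  have IH: "alpha n = u n * alpha m" using Suc by (simp add: m_def)
  have dn: "p dvd 2 * n + 1 \<longleftrightarrow> a = h" unfolding n using a by (rule dvd_num_iff)
  have dd: "p dvd n + 1 \<longleftrightarrow> a = p - 1" unfolding n using a by (rule dvd_den_iff)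
  have nr: "(of_nat n :: rat) = of_nat a + P * of_nat m" by (simp add: n)
  have un: "u n = U n * (if a > h then P * (1/2 + of_nat m) else 1)"
    by (simp add: u_def a_def m_def)
  show ?case
  proof (cases "a = p - 1")
    case True
    have sn: "Suc n = p * Suc m" using n True a by simp
    have "a > h" using True p_eq h_pos by linarith
    then have uu: "u n = U n * (P * (1/2 + of_nat m))" by (simp add: un)
    have "Suc n mod p = 0" "Suc n div p = Suc m" using sn p_ge_3 by simp_all
    then have us: "u (Suc n) = U n * (1/2 + of_nat n)"
      using dn dd True \<open>a > h\<close> by (simp add: u_def U_Suc w_def num_def den_def)
    have "(of_nat (Suc n) :: rat) = P * of_nat (Suc m)" by (simp only: sn of_nat_mult)
    then have "alpha (Suc n) = alpha n * ((1/2 + of_nat n) / (P * of_nat (Suc m)))"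
      by (simp only: alpha_Suc)
    also have "\<dots> = U n * (1/2 + of_nat n) * (alpha m * ((1/2 + of_nat m) / of_nat (Suc m)))"
      using p_ge_3 by (simp add: IH uu field_simps del: of_nat_Suc)
    finally show ?thesis using \<open>Suc n div p = Suc m\<close> by (simp only: us alpha_Suc)
  next
    case False
    then have "Suc a < p" using a by linarith
    moreover have sn: "Suc n = Suc a + p * m" using n by simp
    ultimately have md: "Suc n mod p = Suc a" "Suc n div p = m"
      unfolding sn by (simp_all del: add_Suc)
    have us: "u (Suc n) = U (Suc n) * (if Suc a > h then P * (1/2 + of_nat m) else 1)"
      by (simp only: u_def md)
    have "u (Suc n) = u n * ((1/2 + of_nat n) / of_nat (Suc n))"
    proof (cases "a = h")
      case True
      have "P * (1/2 + of_nat m) = 1/2 + of_nat n"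
        by (simp add: nr True P_eq field_simps)
      then show ?thesis using True False dn dd
        by (simp add: un us U_Suc w_def num_def den_def del: of_nat_Suc)
    next
      case ah: False
      then have "Suc a > h \<longleftrightarrow> a > h" by linarith
      then show ?thesis using ah False dn dd
        by (simp add: un us U_Suc w_def num_def den_def del: of_nat_Suc)
    qed
    then show ?thesis by (simp only: md alpha_Suc IH mult_ac)
  qed
qed

subsection \<open>Expansion modulo \<open>p^2\<close>\<close>

definition H :: "nat \<Rightarrow> rat" where "H n = (\<Sum>i=1..n. 1 / of_nat i)"

lemma H_0 [simp]: "H 0 = 0" and H_Suc: "H (Suc n) = H n + 1 / of_nat (Suc n)"
  by (simp_all add: H_def)

lemma not_dvd_less: "0 < i \<Longrightarrow> i < p \<Longrightarrow> \<not> p dvd i"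
  by (auto dest: dvd_imp_le)

lemma pint_H: "n < p \<Longrightarrow> pint (H n)"
  unfolding H_def by (intro pint_sum pint_inverse_of_nat not_dvd_less) auto

lemma pcong_2_one_plus_mult:
  assumes "pint x" "pint y"
  shows "pcong p 2 ((1 + P * x) * (1 + P * y)) (1 + P * (x + y))"
  using assms by (intro pcongI[of _ _ "x * y"]) (auto simp: algebra_simps power2_eq_square)

lemma pcong_2_one_plus_power:
  assumes "pint x" shows "pcong p 2 ((1 + P * x) ^ n) (1 + P * (of_nat n * x))"
proof (induction n)
  case (Suc n)
  have "pcong p 2 ((1 + P * x) * (1 + P * x) ^ n) ((1 + P * x) * (1 + P * (of_nat n * x)))"
    using assms by (intro pcong_mult Suc.IH pcong_refl) auto
  also have "pcong p 2 \<dots> (1 + P * (x + of_nat n * x))"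
    using assms by (intro pcong_2_one_plus_mult) auto
  finally show ?case by (simp add: algebra_simps)
qed (simp add: pcong_refl)

lemma h_less_p: "h < p"
  using p_eq by linarith

lemma prod_one_plus:
  "n < p \<Longrightarrow> pcong p 2 (\<Prod>i=1..n. 1 + P * (1 / of_nat i)) (1 + P * H n)"
proof (induction n)
  case (Suc n)
  have i: "pint (1 / of_nat (Suc n))" using Suc.prems by (intro pint_inverse_of_nat not_dvd_less) auto
  have "(\<Prod>i=1..Suc n. 1 + P * (1 / of_nat i)) =
      (\<Prod>i=1..n. 1 + P * (1 / of_nat i)) * (1 + P * (1 / of_nat (Suc n)))"
    by (simp del: of_nat_Suc)
  also have "pcong p 2 \<dots> ((1 + P * H n) * (1 + P * (1 / of_nat (Suc n))))"
    using Suc i by (intro pcong_mult pcong_refl pint_add pint_mult) auto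
  also have "pcong p 2 \<dots> (1 + P * (H n + 1 / of_nat (Suc n)))"
    using Suc.prems i by (intro pcong_2_one_plus_mult pint_H) auto
  finally show ?case by (simp only: H_Suc)
qed (simp add: pcong_refl)

lemma diff_divide_eqI: "x - y * q = k * t \<Longrightarrow> q \<noteq> 0 \<Longrightarrow> x / q - y = k * (t / q)"
  for x y q k t :: rat
  by (simp add: field_simps)

text \<open>This pairing suits \<open>num\<close>: in a block of length \<open>p\<close> the middle
  factor is 1, and factors at equal distance from it are opposite modulo \<open>p\<close>.\<close>

lemma prod_centered: "(\<Prod>j<2 * k + 1. f j) = f k * (\<Prod>i=1..k. f (k - i) * f (k + i))"
  for f :: "nat \<Rightarrow> rat"
proof -
  have "(\<Prod>j<2 * k + 1. f j) = (\<Prod>j<k. f j) * (\<Prod>j=k..<2 * k + 1. f j)"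
    using prod.atLeastLessThan_concat[of 0 k "2 * k + 1" f] by (simp only: lessThan_atLeast0)
  moreover have "(\<Prod>j=k..<2 * k + 1. f j) = f k * (\<Prod>j=k + 1..<2 * k + 1. f j)"
    using prod.atLeast_Suc_lessThan[of k "2 * k + 1" f] by simp
  moreover have "(\<Prod>j<k. f j) = (\<Prod>i=1..k. f (k - i))"
    by (rule prod.reindex_bij_witness[of _ "\<lambda>i. k - i" "\<lambda>j. k - j"]) auto
  moreover have "(\<Prod>j=k + 1..<2 * k + 1. f j) = (\<Prod>i=1..k. f (k + i))"
    by (rule prod.reindex_bij_witness[of _ "\<lambda>i. k + i" "\<lambda>j. j - k"]) auto
  ultimately show ?thesis by (simp only: prod.distrib mult_ac)
qed

text \<open>This pairing suits \<open>den\<close>: in a block the last factor is 1, and the partners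
  are congruent to \<open>i\<close> and \<open>- i\<close> modulo \<open>p\<close>.\<close>

lemma prod_paired: "(\<Prod>j<2 * k + 1. f j) = f (2 * k) * (\<Prod>i=1..k. f (i - 1) * f (2 * k - i))"
  for f :: "nat \<Rightarrow> rat"
proof -
  have "(\<Prod>j<2 * k. f j) = (\<Prod>j<k. f j) * (\<Prod>j=k..<2 * k. f j)"
    using prod.atLeastLessThan_concat[of 0 k "2 * k" f] by (simp add: lessThan_atLeast0)
  moreover have "(\<Prod>j<k. f j) = (\<Prod>i=1..k. f (i - 1))"
    by (rule prod.reindex_bij_witness[of _ "\<lambda>i. i - 1" "\<lambda>j. j + 1"]) auto
  moreover have "(\<Prod>j=k..<2 * k. f j) = (\<Prod>i=1..k. f (2 * k - i))"
    by (rule prod.reindex_bij_witness[of _ "\<lambda>i. 2 * k - i" "\<lambda>j. 2 * k - j"]) auto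
  ultimately show ?thesis by (simp add: prod.distrib)
qed

lemma num_near: "a < p \<Longrightarrow> a \<noteq> h \<Longrightarrow> num (a + p * m) = 1/2 + of_nat a + P * of_nat m"
  unfolding num_def using dvd_num_iff[of a m] by simp

lemma den_near: "a < p - 1 \<Longrightarrow> den (a + p * m) = of_nat (a + 1) + P * of_nat m"
  unfolding den_def using dvd_den_iff[of a m] by simp

text \<open>Modulo \<open>p^2\<close>, with r = i, a pair of numerators gives \<open>- r^2\<close>
  and a pair of denominators \<open>- r^2 + P * r\<close>; their quotient is
  \<open>1 + P / r\<close>, whatever \<open>m\<close> is.\<close>

lemma w_block: "pcong p 2 (\<Prod>j<p. w (j + p * m)) (1 + P * H h)"
proof -
  let ?N = "\<lambda>i. num (h - i + p * m) * num (h + i + p * m)"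
  let ?D = "\<lambda>i. den (i - 1 + p * m) * den (2 * h - i + p * m)"
  have "num (h + p * m) = 1" "den (2 * h + p * m) = 1"
    using dvd_num_iff[of h m] dvd_den_iff[of "2 * h" m] p_eq by (auto simp: num_def den_def)
  then have N: "(\<Prod>j<p. num (j + p * m)) = (\<Prod>i=1..h. ?N i)"
    and D: "(\<Prod>j<p. den (j + p * m)) = (\<Prod>i=1..h. ?D i)"
    using prod_centered[of "\<lambda>j. num (j + p * m)" h] prod_paired[of "\<lambda>j. den (j + p * m)" h]
    unfolding p_eq by (simp_all only: mult_1_left)
  have factor: "pcong p 2 (?N i / ?D i) (1 + P * (1 / of_nat i))" if i: "i \<in> {1..h}" for i
  proof -
    define r c :: rat where "r = of_nat i" and "c = of_nat m"
    \<comment> \<open>The numerator pair minus \<open>1 + P / r\<close> times the denominator pair,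
      divided by \<open>P^2\<close>.\<close>
    define t where "t = (1/2 + c)^2 - 1 - (1 + P / r) * (c + c^2)"
    have r: "r \<noteq> 0" using i by (simp add: r_def)
    have h': "(of_nat h :: rat) = P/2 - 1/2" using P_eq by (simp add: field_simps)
    have "h - i < p" "h - i \<noteq> h" "h + i < p" "h + i \<noteq> h" using i p_eq by auto
    then have "num (h - i + p * m) = 1/2 + of_nat (h - i) + P * of_nat m"
      "num (h + i + p * m) = 1/2 + of_nat (h + i) + P * of_nat m"
      using num_near by blast+
    moreover have "(of_nat (h - i) :: rat) = of_nat h - of_nat i" using i by (simp add: of_nat_diff)
    ultimately have n: "?N i = (P * (1/2 + c) - r) * (P * (1/2 + c) + r)"
      by (simp only: r_def c_def h' of_nat_add) (simp add: algebra_simps)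
    have "i - 1 < p - 1" "2 * h - i < p - 1" using i p_eq by auto
    moreover have "i - 1 + 1 = i" using i by simp
    moreover have "2 * h - i + 1 = p - i" using i p_eq by auto
    moreover have "i \<le> p" using i p_eq by simp
    ultimately have d: "?D i = (r + P * c) * (P - r + P * c)"
      using den_near[of "i - 1" m] den_near[of "2 * h - i" m] by (simp only: of_nat_diff r_def c_def)
    have D: "punit (?D i)" by simp
    have "?N i - (1 + P * (1 / r)) * ?D i = P^2 * t"
      unfolding n d t_def using r by (simp add: field_simps power2_eq_square)
    then have "?N i / ?D i - (1 + P * (1 / r)) = P^2 * (t / ?D i)"
      using punitD(2)[OF D] by (rule diff_divide_eqI)
    moreover have ru: "punit r" unfolding r_def using i p_eq
      by (intro punit_of_nat not_dvd_less) auto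
    moreover from this have "pint (1 / r)" by (intro pint_divide) auto
    moreover from this have "pint t" unfolding t_def c_def
      using pint_mult[of P "1 / r"] by (intro pint_diff pint_mult pint_add pint_power) auto
    ultimately show ?thesis unfolding r_def[symmetric]
      by (intro pcongI[of _ _ "t / ?D i"] pint_divide D pint_add pint_mult[of P "1 / r"])
        (auto simp: punitD)
  qed
  have "(\<Prod>j<p. w (j + p * m)) = (\<Prod>i=1..h. ?N i / ?D i)"
    unfolding w_def prod_dividef N D ..
  also have "pcong p 2 \<dots> (\<Prod>i=1..h. 1 + P * (1 / of_nat i))"
    by (intro pcong_prod factor)
  also have "pcong p 2 \<dots> (1 + P * H h)" by (intro prod_one_plus h_less_p)
  finally show ?thesis .
qed

lemma U_multiple: "pcong p 2 (U (p * m)) (1 + P * (of_nat m * H h))"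
proof (induction m)
  case (Suc m)
  have "U (p * Suc m) = U (p * m) * (\<Prod>j<p. w (j + p * m))"
    using U_add[of p "p * m"] by simp
  also have "pcong p 2 \<dots> ((1 + P * (of_nat m * H h)) * (1 + P * H h))"
    by (intro pcong_mult Suc.IH w_block)
  also have "pcong p 2 \<dots> (1 + P * (of_nat m * H h + H h))"
    by (intro pcong_2_one_plus_mult pint_mult pint_H h_less_p pint_of_nat)
  finally show ?case by (simp add: algebra_simps)
qed (simp add: pcong_refl)

lemma half_plus: "a \<le> h \<Longrightarrow> 1/2 + of_nat a = P/2 - (of_nat (h - a) :: rat)"
  using P_eq by (simp add: of_nat_diff field_simps)

text \<open>First-order expansion in \<open>P * m\<close>: the logarithmic derivative is 1/(1/2 + a)
  - 1/(a + 1), and 1/2 + a is congruent to -(h - a) modulo \<open>p\<close>.\<close>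

lemma w_near:
  assumes "a < h"
  shows "pcong p 2 (w (a + p * m))
    (w a * (1 + P * (of_nat m * (- 1 / of_nat (h - a) - 1 / of_nat (Suc a)))))"
proof -
  define b c e M :: rat
    where "b = 1/2 + of_nat a" and "c = of_nat (Suc a)" and "e = of_nat (h - a)" and "M = of_nat m"
  have bounds: "a < p" "a \<noteq> h" "a < p - 1" "Suc a < p" "h - a < p" "0 < h - a"
    using assms p_eq by linarith+
  have wm: "w (a + p * m) = (b + P * M) / (c + P * M)"
    using bounds by (simp add: w_def num_near den_near b_def c_def M_def)
  have wa: "w a = b / c"
    using bounds num_near[of a 0] den_near[of a 0] by (simp add: w_def b_def c_def)
  have be: "b = P/2 - e" using half_plus[of a] assms by (simp add: b_def e_def)
  have e: "punit e" unfolding e_def using bounds by (intro punit_of_nat not_dvd_less) auto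
  have c: "punit c" unfolding c_def using bounds by (intro punit_of_nat not_dvd_less) auto
  have cM: "punit (c + P * M)"
    using punit_den[of "a + p * m"] bounds by (simp add: den_near c_def M_def)
  have b: "pint b" unfolding b_def by (intro pint_add) auto
  have inv: "pint (1 / e)" "pint (1 / c)" using pint_divide[OF pint_1] e c by auto
  \<comment> \<open>After clearing denominators the linear terms leave
    \<open>P * M * (b + e) / e\<close>; since \<open>b + e = P/2\<close>, a second factor
    \<open>P\<close> appears.\<close>
  define t where "t = (M * (1/2) * (1 / e) + M^2 * b * (1 / e + 1 / c) * (1 / c)) / (c + P * M)"
  have M: "pint M" by (simp add: M_def)
  have "pint t" unfolding t_def
    by (intro pint_divide cM pint_add pint_mult inv b M pint_power pint_half)
  moreover have "(b + P * M) / (c + P * M) - b / c * (1 + P * (M * (- 1 / e - 1 / c))) = P^2 * t"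
  proof -
    have nz: "c \<noteq> 0" "e \<noteq> 0" "c + P * M \<noteq> 0" using punitD(2) e c cM by auto
    have "(b + P * M) - b / c * (1 + P * (M * (- 1 / e - 1 / c))) * (c + P * M)
        = P^2 * (M * (1/2) * (1 / e) + M^2 * b * (1 / e + 1 / c) * (1 / c))"
      unfolding be using nz(1,2) by (simp add: field_simps power2_eq_square)
    then show ?thesis unfolding t_def using nz(3) by (rule diff_divide_eqI)
  qed
  ultimately show ?thesis
    unfolding wm wa c_def[symmetric] e_def[symmetric] M_def[symmetric]
    using b c cM M inv e
    by (intro pcongI[of _ _ t] pint_divide pint_mult pint_add pint_diff) (auto simp flip: minus_divide_left)
qed

text \<open>The \<open>m\<close> full blocks give the case a = 0. Each further factor
  \<open>w\<close> subtracts 1/(h - a) and 1/(a + 1), which is exactly the change of the harmonic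
  difference.\<close>

lemma U_near:
  assumes "a \<le> h"
  shows "pcong p 2 (U (a + p * m)) (U a * (1 + P * (of_nat m * (H (h - a) - H a))))"
  using assms
proof (induction a)
  case 0
  then show ?case using U_multiple by simp
next
  case (Suc a)
  define G g where "G = H (h - a) - H a" and "g = - 1 / of_nat (h - a) - 1 / (of_nat (Suc a) :: rat)"
  have bounds: "Suc a < p" "h - a < p" "0 < h - a" "a < p"
    using Suc.prems p_eq by linarith+
  have G: "pint G" unfolding G_def using bounds by (intro pint_diff pint_H)
  have "g = - (1 / of_nat (h - a)) - 1 / of_nat (Suc a)" by (simp add: g_def)
  then have g: "pint g"
    by (simp only:) (intro pint_diff pint_uminus pint_inverse_of_nat not_dvd_less, use bounds in auto)
  have "h - a = Suc (h - Suc a)" using Suc.prems by simp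
  then have Gg: "H (h - Suc a) - H (Suc a) = G + g"
    unfolding G_def g_def by (simp add: H_Suc del: of_nat_Suc)
  have "U (Suc a + p * m) = U (a + p * m) * w (a + p * m)" by (simp add: U_Suc)
  also have "pcong p 2 \<dots> ((U a * (1 + P * (of_nat m * G))) * (w a * (1 + P * (of_nat m * g))))"
    unfolding G_def g_def using Suc by (intro pcong_mult w_near) auto
  also have "\<dots> = U (Suc a) * ((1 + P * (of_nat m * G)) * (1 + P * (of_nat m * g)))"
    by (simp add: U_Suc)
  also have "pcong p 2 \<dots> (U (Suc a) * (1 + P * (of_nat m * G + of_nat m * g)))"
    using G g by (intro pcong_mult pcong_refl pcong_2_one_plus_mult) (auto simp: punitD)
  finally show ?case by (simp only: Gg distrib_left)
qed

text \<open>In this range \<open>U a\<close> is \<open>alpha a\<close>, that is (-1)^a times the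
  binomial coefficient of -1/2 over a, and -1/2 is congruent to \<open>h\<close> modulo
  \<open>p\<close>.\<close>

lemma U_binomial:
  assumes "a \<le> h" shows "pcong p 1 (U a) ((-1) ^ a * of_nat (h choose a))"
  using assms
proof (induction a)
  case (Suc a)
  have bounds: "a < p" "a \<noteq> h" "a < p - 1" "Suc a < p" "0 < Suc a"
    using Suc.prems p_eq by linarith+
  have u: "punit (of_nat (Suc a))" using bounds by (intro punit_of_nat not_dvd_less)
  have "w a = (1/2 + of_nat a) / of_nat (Suc a)"
    using bounds num_near[of a 0] den_near[of a 0] by (simp add: w_def)
  moreover have "pcong p 1 (1/2 + of_nat a) (- of_nat (h - a))"
    using half_plus[of a] Suc.prems
    by (intro pcongI[of _ _ "1/2"] pint_add pint_uminus) (auto)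
  ultimately have w: "pcong p 1 (w a) (- of_nat (h - a) / of_nat (Suc a))"
    by (simp only:) (intro pcong_divide pcong_refl u pint_of_nat)
  have "U (Suc a) = U a * w a" by (rule U_Suc)
  also have "pcong p 1 \<dots> ((-1) ^ a * of_nat (h choose a) * (- of_nat (h - a) / of_nat (Suc a)))"
    using Suc w by (intro pcong_mult) auto
  also have "\<dots> = (-1) ^ Suc a * of_nat (h choose Suc a)"
  proof -
    have "(of_nat (Suc a * (h choose Suc a)) :: rat) = of_nat ((h - a) * (h choose a))"
      by (simp only: binomial_absorb_comp binomial_absorption)
    then have "of_nat (h choose a) * of_nat (h - a) = (of_nat (Suc a) * of_nat (h choose Suc a) :: rat)"
      by (simp only: of_nat_mult mult.commute)
    then show ?thesis by (simp add: field_simps del: of_nat_Suc)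
  qed
  finally show ?case .
qed (simp add: pcong_refl)

end

section \<open>The supercongruence\<close>

lemma sign_power_cong: "z = 1 \<or> z = -1 \<Longrightarrow> even i = even j \<Longrightarrow> z ^ i = z ^ j" for z :: rat
  by (auto simp: minus_one_power_iff)

locale central_binomial_power_series = odd_prime +
  fixes d :: nat and z :: rat
  assumes d: "d \<ge> 2" and z: "z = (-1) ^ (d * h)"
begin

lemma z_sign: "z = 1 \<or> z = -1"
  by (simp add: z minus_one_power_iff)

lemma pint_z: "pint z"
  using z_sign pint_uminus[OF pint_1] by auto

definition A :: "nat \<Rightarrow> rat" where "A n = alpha n ^ d * z ^ n"

definition R :: "nat \<Rightarrow> rat" where "R n = u n ^ d * z ^ (n + n div p)"

sublocale dwork_sequence p A R
proof
  show "A 0 = 1" by (simp add: A_def alpha_0)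
  show "A n = R n * A (n div p)" for n
  proof -
    have "z ^ n = z ^ (n + n div p + n div p)" by (rule sign_power_cong[OF z_sign]) auto
    also have "\<dots> = z ^ (n + n div p) * z ^ (n div p)" by (rule power_add)
    finally show ?thesis unfolding A_def R_def alpha_rec[of n] by (simp add: power_mult_distrib)
  qed
  have "lip (\<lambda>n. z ^ (n + n div p))" unfolding lip_def
  proof (intro allI)
    fix k n m
    show "pcong p k (z ^ (n + p ^ k * m + (n + p ^ k * m) div p)) (z ^ (n + n div p))"
    proof (cases k)
      case 0
      then show ?thesis using pint_z by (simp add: pcong_0_iff)
    next
      case (Suc l)
      have "(n + p ^ k * m) div p = n div p + p ^ l * m"
        using Suc p_ge_3 by (simp add: mult.assoc)
      \<comment> \<open>The exponent grows by \<open>p^l * m * (p + 1)\<close>, which is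
        even.\<close>
      then have "z ^ (n + p ^ k * m + (n + p ^ k * m) div p) = z ^ (n + n div p)"
        using odd by (intro sign_power_cong[OF z_sign]) auto
      then show ?thesis using pint_z by (simp add: pcong_refl)
    qed
  qed
  then show "lip R" unfolding R_def by (intro lip_mult lip_power lip_u)
qed

lemma S_one: "S s (\<lambda>_. 1) = Ftrunc d (p ^ s) z"
  by (simp add: S_def A_def Ftrunc_def)

text \<open>For \<open>a \<le> h\<close> this is both \<open>A a\<close> and
  \<open>R a\<close>.\<close>

definition Y :: "nat \<Rightarrow> rat" where "Y a = U a ^ d * z ^ a"

lemma pint_Y: "pint (Y a)"
  unfolding Y_def using punitD(1)[OF punit_U] pint_z by auto

text \<open>This is where the choice of the sign \<open>z\<close> enters.\<close>

lemma Y_symmetric: assumes "a \<le> h" shows "pcong p 1 (Y (h - a)) (Y a)"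
proof -
  \<comment> \<open>\<open>y\<close> collects the signs of \<open>U_binomial\<close> and of
    \<open>z\<close>. The power \<open>y^h\<close> is -1 to the even exponent
    \<open>d * h * (h + 1)\<close>, hence 1.\<close>
  define y where "y = (-1) ^ d * z"
  have y: "y = 1 \<or> y = -1" using z_sign by (auto simp: y_def minus_one_power_iff)
  have "y ^ h = 1"
    unfolding y_def z by (simp flip: power_mult power_add) (auto simp: minus_one_power_iff)
  then have "y ^ (h - a) * y ^ a = 1" using assms by (simp flip: power_add)
  then have sym: "y ^ (h - a) = y ^ a"
    using y by (auto simp: minus_one_power_iff split: if_splits)
  have Y: "pcong p 1 (Y b) (y ^ b * of_nat (h choose b) ^ d)" if "b \<le> h" for b
  proof -
    have "pcong p 1 (Y b) (((-1) ^ b * of_nat (h choose b)) ^ d * z ^ b)"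
      unfolding Y_def using pint_z by (intro pcong_mult pcong_power U_binomial that pcong_refl) auto
    also have "((-1) ^ b * of_nat (h choose b)) ^ d * z ^ b = y ^ b * of_nat (h choose b) ^ d"
      by (simp add: y_def power_mult_distrib mult.commute flip: power_mult)
    finally show ?thesis .
  qed
  have "pcong p 1 (Y (h - a)) (y ^ (h - a) * of_nat (h choose (h - a)) ^ d)" by (intro Y) simp
  also have "\<dots> = y ^ a * of_nat (h choose a) ^ d"
    using assms by (simp add: sym binomial_symmetric[of a h])
  also have "pcong p 1 \<dots> (Y a)" by (rule pcong_sym[OF Y[OF assms]])
  finally show ?thesis .
qed

text \<open>Reflecting a to h - a negates the harmonic difference and preserves \<open>Y\<close>
  modulo \<open>p\<close>, so the sum is congruent to its own negative, and 2 is invertible.\<close>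

lemma sum_Y_harmonic: "pcong p 1 (\<Sum>a\<le>h. Y a * (H (h - a) - H a)) 0"
proof -
  define X where "X = (\<Sum>a\<le>h. Y a * (H (h - a) - H a))"
  have pG: "pint (H (h - a) - H a)" if "a \<le> h" for a
    using that h_less_p by (intro pint_diff pint_H) auto
  have X: "pint X" unfolding X_def using pG pint_Y by (intro pint_sum pint_mult) auto
  have "X = (\<Sum>a\<le>h. Y (h - a) * (H a - H (h - a)))"
    unfolding X_def by (rule sum.reindex_bij_witness[of _ "\<lambda>a. h - a" "\<lambda>a. h - a"]) auto
  then have "X + X = (\<Sum>a\<le>h. Y a * (H (h - a) - H a)) + (\<Sum>a\<le>h. Y (h - a) * (H a - H (h - a)))"
    using X_def by simp
  then have "2 * X = (\<Sum>a\<le>h. (Y a - Y (h - a)) * (H (h - a) - H a))"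
    by (simp add: algebra_simps flip: sum.distrib mult_2)
  also have "pcong p 1 \<dots> (\<Sum>a\<le>h. (Y a - Y a) * (H (h - a) - H a))"
    using pG pint_Y by (intro pcong_sum pcong_mult pcong_diff pcong_refl Y_symmetric) auto
  also have "(\<Sum>a\<le>h. (Y a - Y a) * (H (h - a) - H a)) = 0" by simp
  finally have "pcong p 1 (1/2 * (2 * X)) (1/2 * 0)"
    by (rule pcong_mult[OF pcong_refl[OF pint_half]])
  then show ?thesis by (simp flip: X_def)
qed

section \<open>The image of 1 under T modulo p^2\<close>

lemma R_small: assumes "a \<le> h"
  shows "pcong p 2 (R (a + p * m)) (Y a + P * (Y a * (of_nat (d * m) * (H (h - a) - H a))))"
proof -
  define g where "g = of_nat m * (H (h - a) - H a)"
  have g: "pint g" unfolding g_def using assms h_less_p by (intro pint_mult pint_diff pint_H) auto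
  have md: "(a + p * m) mod p = a" "(a + p * m) div p = m" using assms h_less_p by auto
  have "z ^ (a + p * m + m) = z ^ a" using odd by (intro sign_power_cong[OF z_sign]) auto
  then have "R (a + p * m) = U (a + p * m) ^ d * z ^ a"
    unfolding R_def u_def md using assms by simp
  also have "pcong p 2 \<dots> ((U a * (1 + P * g)) ^ d * z ^ a)"
    unfolding g_def using assms pint_z by (intro pcong_mult pcong_power U_near pcong_refl) auto
  also have "(U a * (1 + P * g)) ^ d * z ^ a = Y a * (1 + P * g) ^ d"
    by (simp add: Y_def power_mult_distrib)
  also have "pcong p 2 \<dots> (Y a * (1 + P * (of_nat d * g)))"
    using g pint_Y by (intro pcong_mult pcong_refl pcong_2_one_plus_power)
  finally show ?thesis by (simp add: g_def algebra_simps)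
qed

text \<open>A last digit beyond \<open>h\<close> puts a factor \<open>P\<close> into
  \<open>u\<close>, and its \<open>d\<close>-th power contains at least two of them.\<close>

lemma R_large: assumes "h < a" "a < p" shows "pcong p 2 (R (a + p * m)) 0"
proof -
  define n where "n = a + p * m"
  define v where "v = U n * (1/2 + of_nat (n div p))"
  have "n mod p = a" using assms by (simp add: n_def)
  then have u: "u n = P * v" using assms by (simp add: u_def v_def)
  have v: "pint v" unfolding v_def by (intro pint_mult pint_add punitD(1)[OF punit_U]) auto
  have "u n ^ d = u n ^ 2 * u n ^ (d - 2)" using d by (simp only: le_add_diff_inverse flip: power_add)
  then have "R n - 0 = P ^ 2 * (v ^ 2 * u n ^ (d - 2) * z ^ (n + n div p))"
    by (simp add: R_def u power_mult_distrib)
  then show ?thesis unfolding n_def[symmetric] using v pint_u pint_z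
    by (intro pcongI[of _ _ "v ^ 2 * u n ^ (d - 2) * z ^ (n + n div p)"] pint_mult pint_power)
      (auto simp: lip_pint[OF lip_R])
qed

text \<open>The dependence on \<open>m\<close> is linear with coefficient \<open>d * P\<close> times
  the sum in \<open>sum_Y_harmonic\<close>, hence divisible by \<open>p^2\<close>.\<close>

lemma T_one: "pcong p 2 (T (\<lambda>_. 1) m) (\<Sum>a\<le>h. Y a)"
proof -
  let ?X = "\<Sum>a\<le>h. Y a * (H (h - a) - H a)"
  have "T (\<lambda>_. 1) m = (\<Sum>a\<in>{..h} \<union> {h<..<p}. R (a + p * m))"
    unfolding T_def using h_less_p by (intro sum.cong) auto
  also have "\<dots> = (\<Sum>a\<le>h. R (a + p * m)) + (\<Sum>a\<in>{h<..<p}. R (a + p * m))"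
    by (intro sum.union_disjoint) auto
  also have "pcong p 2 \<dots> ((\<Sum>a\<le>h. Y a + P * (Y a * (of_nat (d * m) * (H (h - a) - H a))))
      + (\<Sum>a\<in>{h<..<p}. 0))"
    by (intro pcong_add pcong_sum R_small R_large) auto
  also have "\<dots> = (\<Sum>a\<le>h. Y a) + of_nat (d * m) * (P * ?X)"
  proof -
    have "P * (Y a * (c * g)) = c * (P * (Y a * g))" for a c g by simp
    then show ?thesis by (simp only: sum.distrib sum_distrib_left sum.neutral_const add_0_right)
  qed
  also have "pcong p 2 \<dots> ((\<Sum>a\<le>h. Y a) + of_nat (d * m) * (P * 0))"
  proof -
    have X: "pcong p 2 (P * ?X) (P * 0)"
      using pcong_P_mult[OF sum_Y_harmonic] by (simp add: numeral_2_eq_2)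
    show ?thesis
      by (intro pcong_add pcong_mult[OF pcong_refl[OF pint_of_nat] X] pcong_refl pint_sum pint_Y)
  qed
  finally show ?thesis by simp
qed

end

theorem theorem1p1:
  fixes d p :: nat
  defines "eps \<equiv> ((-1::rat) ^ (d * (p - 1) div 2))"
  assumes "d \<ge> 2" and "prime p" and "odd p"
    and "p_unit p (Ftrunc d p eps)"
  shows "(\<forall>s\<ge>1. p_unit p (Ftrunc d (p ^ s) eps))
    \<and> (\<exists>f. Zp p f
          \<and> padic_tendsto p (\<lambda>s. Ftrunc d (p ^ s) eps / Ftrunc d (p ^ (s - 1)) eps) f
          \<and> rat_cong p (Ftrunc d p eps) (f 2) 2)"
proof -
  interpret odd_prime p using assms(3,4) by unfold_locales
  have "p - 1 = 2 * h" using p_eq by linarith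
  then have "d * (p - 1) div 2 = d * h" by simp
  then interpret central_binomial_power_series p d eps
    using assms(2) by unfold_locales (simp_all add: eps_def)
  have F1: "F 1 = Ftrunc d p eps" by (simp add: S_one)
  then have unit: "p_unit p (F 1)" using assms(5) by simp
  obtain f where f: "Zp p f" "padic_tendsto p (\<lambda>s. F s / F (s - 1)) f"
      "\<And>k. pcong p k (F k / F (k - 1)) (of_int (f k))"
    using F_quotient_limit[OF unit] by blast
  \<comment> \<open>Division by the unit \<open>F 1\<close> turns \<open>F_2_cong\<close> into a
    statement about the quotient \<open>F 2 / F 1\<close>, whose residue modulo \<open>p^2\<close>
    is \<open>f 2\<close>.\<close>
  have "pcong p 2 (F 2 / F 1) (F 1 ^ 2 / F 1)"
    by (intro pcong_divide F_2_cong[OF T_one] pcong_refl pint_F unit)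
  moreover have "F 1 ^ 2 / F 1 = F 1" by (simp add: power2_eq_square)
  ultimately have "pcong p 2 (F 1) (F 2 / F 1)" using pcong_sym by metis
  also have "pcong p 2 (F 2 / F 1) (of_int (f 2))" using f(3)[of 2] by simp
  finally have "rat_cong p (F 1) (f 2) 2" by (simp only: rat_cong_iff)
  then show ?thesis
    using f(1,2) punit_F[OF unit] unfolding S_one by auto
qed

end
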